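(* Let $X\subset\mathbb{R}^3$ be a smooth tropical surface of degree $2$, and let $\overline{X}$ denote its unique compact $2$-cell. For each point $p\in\overline{X}$ there exist two distinct tropical lines contained in $X$ and passing through $p$.
   Context: A tropical polynomial in three variables is a function $f(x)=\max_{a\in\mathcal{A}}\{\lambda_a+\langle a,x\rangle\}$ on $\mathbb{R}^3$, with $\mathcal{A}\subset\mathbb{Z}_{\ge 0}^3$ finite and $\lambda_a\in\mathbb{R}$. The tropical surface $V_{tr}(f)\subset\mathbb{R}^3$ is the set of points where the maximum is attained at least twice. $\operatorname{conv}(\mathcal{A})$ is the Newton polytope of $f$, and $\operatorname{Subdiv}(f)$ is the subdivision of it obtained by projecting the upper (top) faces of $\operatorname{conv}\{(a,\lambda_a): a\in\mathcal{A}\}\subset\mathbb{R}^4$ to $\mathbb{R}^3$. $V_{tr}(f)$ is a polyhedral complex of pure dimension 2 whose (closed) cells are the sets $\Delta^\vee$, for $\Delta\in\operatorname{Subdiv}(f)$ of dimension $\geq 1$: if $\Delta$ has vertices $a_1,\dots,a_r$, then $\Delta^\vee=\{x:\lambda_{a_1}+\langle a_1,x\rangle=\dots=\lambda_{a_r}+\langle a_r,x\rangle\ge\lambda_b+\langle b,x\rangle\ \forall b\in\mathcal{A}\}$, of dimension $3-\dim\Delta$. For a positive integer $\delta$ let $\Gamma_\delta=\operatorname{conv}\{(0,0,0),(\delta,0,0),(0,\delta,0),(0,0,\delta)\}$. The surface $X=V_{tr}(f)$ has degree $\delta$ if the Newton polytope of $f$ is $\Gamma_\delta$, and it is smooth if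 moreover $\operatorname{Subdiv}(f)$ is an elementary (unimodular) triangulation of $\Gamma_\delta$, i.e. all its maximal elements are lattice tetrahedra of volume $\frac16$. A smooth tropical surface of degree 2 has exactly one compact 2-cell. Tropical lines in $\mathbb{R}^3$: put $\omega_1=-e_1$, $\omega_2=-e_2$, $\omega_3=-e_3$, $\omega_4=e_1+e_2+e_3$. A tropical line is a set consisting, for some partition $\{1,2,3,4\}=\{i,j\}\sqcup\{k,l\}$, some $v_1\in\mathbb{R}^3$ and some $s\ge0$, with $v_2=v_1+s(\omega_k+\omega_l)$, of the segment $[v_1,v_2]$, the two unbounded rays from $v_1$ in directions $\omega_i,\omega_j$, and the two unbounded rays from $v_2$ in directions $\omega_k,\omega_l$. It is degenerate if $s=0$. *)

theory Defs
  imports "HOL-Analysis.Analysis"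
begin

text \<open>
  A tropical polynomial in three variables is given by its finite set \<open>A\<close> of exponents and
  its coefficients \<open>l\<close>, of which only the values on \<open>A\<close> matter.
\<close>

definition expo :: "nat ^ 3 \<Rightarrow> real ^ 3" where
  "expo a = (\<chi> i. real (a $ i))"

definition trop_term :: "(nat ^ 3 \<Rightarrow> real) \<Rightarrow> nat ^ 3 \<Rightarrow> real ^ 3 \<Rightarrow> real" where
  "trop_term l a x = l a + expo a \<bullet> x"

definition trop_poly :: "(nat ^ 3) set \<Rightarrow> (nat ^ 3 \<Rightarrow> real) \<Rightarrow> real ^ 3 \<Rightarrow> real" where
  "trop_poly A l x = Max ((\<lambda>a. trop_term l a x) ` A)"

definition trop_surface :: "(nat ^ 3) set \<Rightarrow> (nat ^ 3 \<Rightarrow> real) \<Rightarrow> (real ^ 3) set" where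
  "trop_surface A l = {x. \<exists>a\<in>A. \<exists>b\<in>A. a \<noteq> b \<and>
     trop_term l a x = trop_poly A l x \<and> trop_term l b x = trop_poly A l x}"

definition newton_polytope :: "(nat ^ 3) set \<Rightarrow> (real ^ 3) set" where
  "newton_polytope A = convex hull (expo ` A)"

definition lifted_polytope ::
  "(nat ^ 3) set \<Rightarrow> (nat ^ 3 \<Rightarrow> real) \<Rightarrow> ((real ^ 3) \<times> real) set" where
  "lifted_polytope A l = convex hull ((\<lambda>a. (expo a, l a)) ` A)"

text \<open>
  A nonempty face is an upper face if it is cut out by a supporting hyperplane whose
  outer normal \<open>(u, t)\<close> points upwards, i.e. \<open>t > 0\<close>.
\<close>

definition upper_face :: "((real ^ 3) \<times> real) set \<Rightarrow> ((real ^ 3) \<times> real) set \<Rightarrow> bool" where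
  "upper_face F P \<longleftrightarrow> F face_of P \<and> F \<noteq> {} \<and>
     (\<exists>u t h. t > 0 \<and> P \<subseteq> {y. (u, t) \<bullet> y \<le> h} \<and> F = P \<inter> {y. (u, t) \<bullet> y = h})"

definition Subdiv :: "(nat ^ 3) set \<Rightarrow> (nat ^ 3 \<Rightarrow> real) \<Rightarrow> (real ^ 3) set set" where
  "Subdiv A l = {fst ` F | F. upper_face F (lifted_polytope A l)}"

text \<open>
  Every vertex of a member of \<open>Subdiv A l\<close> is \<open>expo a\<close> for some \<open>a \<in> A\<close>, so
  \<open>vertex_expos\<close> lists all its vertices.
\<close>

definition vertex_expos :: "(nat ^ 3) set \<Rightarrow> (real ^ 3) set \<Rightarrow> (nat ^ 3) set" where
  "vertex_expos A D = {a \<in> A. expo a extreme_point_of D}"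

definition dual_cell ::
  "(nat ^ 3) set \<Rightarrow> (nat ^ 3 \<Rightarrow> real) \<Rightarrow> (real ^ 3) set \<Rightarrow> (real ^ 3) set" where
  "dual_cell A l D = {x.
     (\<forall>a\<in>vertex_expos A D. \<forall>a'\<in>vertex_expos A D. trop_term l a x = trop_term l a' x) \<and>
     (\<forall>a\<in>vertex_expos A D. \<forall>b\<in>A. trop_term l a x \<ge> trop_term l b x)}"

definition surface_cells :: "(nat ^ 3) set \<Rightarrow> (nat ^ 3 \<Rightarrow> real) \<Rightarrow> (real ^ 3) set set" where
  "surface_cells A l = {dual_cell A l D | D. D \<in> Subdiv A l \<and> aff_dim D \<ge> 1}"

definition compact_2cell :: "(nat ^ 3) set \<Rightarrow> (nat ^ 3 \<Rightarrow> real) \<Rightarrow> (real ^ 3) set \<Rightarrow> bool" where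
  "compact_2cell A l C \<longleftrightarrow> C \<in> surface_cells A l \<and> aff_dim C = 2 \<and> compact C"

definition Gamma_simplex :: "nat \<Rightarrow> (real ^ 3) set" where
  "Gamma_simplex d = convex hull
     {vector [0, 0, 0], vector [real d, 0, 0], vector [0, real d, 0], vector [0, 0, real d]}"

definition lattice_tetrahedron :: "(real ^ 3) set \<Rightarrow> bool" where
  "lattice_tetrahedron T \<longleftrightarrow> 3 simplex T \<and> (\<forall>v. v extreme_point_of T \<longrightarrow> (\<forall>i. v $ i \<in> \<int>))"

definition elementary_subdivision :: "(real ^ 3) set set \<Rightarrow> bool" where
  "elementary_subdivision S \<longleftrightarrow>
     (\<forall>D\<in>S. (\<forall>D'\<in>S. D \<subseteq> D' \<longrightarrow> D' = D) \<longrightarrow>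
        lattice_tetrahedron D \<and> measure lebesgue D = 1 / 6)"

definition has_degree :: "(nat ^ 3) set \<Rightarrow> nat \<Rightarrow> bool" where
  "has_degree A d \<longleftrightarrow> d > 0 \<and> newton_polytope A = Gamma_simplex d"

definition smooth_of_degree :: "(nat ^ 3) set \<Rightarrow> (nat ^ 3 \<Rightarrow> real) \<Rightarrow> nat \<Rightarrow> bool" where
  "smooth_of_degree A l d \<longleftrightarrow> has_degree A d \<and> elementary_subdivision (Subdiv A l)"

text \<open>Only the arguments 1, 2, 3, 4 of \<open>omega\<close> are used.\<close>

definition omega :: "nat \<Rightarrow> real ^ 3" where
  "omega i =
     (if i = 1 then vector [-1, 0, 0]
      else if i = 2 then vector [0, -1, 0]
      else if i = 3 then vector [0, 0, -1]
      else vector [1, 1, 1])"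

definition ray :: "real ^ 3 \<Rightarrow> real ^ 3 \<Rightarrow> (real ^ 3) set" where
  "ray v w = {v + t *\<^sub>R w | t. t \<ge> 0}"

definition tropical_line :: "(real ^ 3) set \<Rightarrow> bool" where
  "tropical_line L \<longleftrightarrow>
     (\<exists>i j k m v1 v2 s.
        {i, j} \<union> {k, m} = {1, 2, 3, 4} \<and> {i, j} \<inter> {k, m} = {} \<and>
        s \<ge> 0 \<and> v2 = v1 + s *\<^sub>R (omega k + omega m) \<and>
        L = closed_segment v1 v2 \<union> ray v1 (omega i) \<union> ray v1 (omega j)
              \<union> ray v2 (omega k) \<union> ray v2 (omega m))"

end

theory Submission
  imports Defs
begin

text \<open>
  Homogenise the exponents to four coordinates \<open>hexpo a i\<close> with sum 2. The compact 2-cell is dual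
  to the only interior edge of the triangulation, whose ends are the monomials \<open>x\<^sub>i x\<^sub>j\<close> and
  \<open>x\<^sub>k x\<^sub>m\<close> for a partition \<open>{i, j} \<union> {k, m}\<close> of the four variables. As for a classical quadric
  there are two rulings: from a point \<open>p\<close> of the cell one moves along \<open>\<plusminus>(omega i + omega k)\<close>,
  respectively \<open>\<plusminus>(omega i + omega m)\<close>, until a third monomial becomes maximal, and branches there.
  The two lines can only agree if both are degenerate with vertex \<open>p\<close>; then the monomials maximal
  at \<open>p\<close> include the square of a variable \<open>x\<close>, the square of a variable \<open>y\<close> and \<open>x y\<close>,
  which cannot be vertices of one tetrahedron.
\<close>

section \<open>Lattice points of unimodular simplices\<close>

text \<open>The edge vectors at one vertex form an integral matrix of determinant 1 or -1, so by
  Cramer's rule the barycentric coordinates of a lattice point are integers. As they are nonnegative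
  with sum 1, one of them is 1.\<close>

lemma lattice_point_of_unimodular_simplex:
  fixes X :: "(real ^ 'n :: {finite, wellorder}) set"
  assumes fin: "finite X" and card: "card X = Suc CARD('n)"
    and int: "\<And>v i. v \<in> X \<Longrightarrow> v $ i \<in> \<int>"
    and vol: "measure lborel (convex hull X) = 1 / fact CARD('n)"
    and z: "z \<in> convex hull X" "\<And>i. z $ i \<in> \<int>"
  shows "z \<in> X"
proof -
  obtain x0 where x0: "x0 \<in> X" using card by (metis card.empty equals0I nat.distinct(1))
  have "card (X - {x0}) = CARD('n)" using fin card x0 by simp
  then obtain f where f: "bij_betw f (UNIV :: 'n set) (X - {x0})"
    using fin by (metis finite_Diff finite_class.finite_UNIV finite_same_card_bij)
  define M where "M = (\<chi> i. \<chi> j. f j $ i - x0 $ i)"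
  have fX: "f j \<in> X" for j using f by (auto simp: bij_betw_def)
  have "\<bar>det M\<bar> = 1"
    using content_simplex[OF fin card x0 f] vol by (simp add: M_def)
  obtain u where u: "\<And>x. x \<in> X \<Longrightarrow> 0 \<le> u x" "sum u X = 1" "(\<Sum>x\<in>X. u x *\<^sub>R x) = z"
    using z(1) fin by (auto simp: convex_hull_finite)
  define y where "y = (\<chi> j. u (f j))"
  have reind: "sum g (X - {x0}) = (\<Sum>j\<in>UNIV. g (f j))" for g :: "_ \<Rightarrow> real"
    using sum.reindex_bij_betw[OF f, of g] by simp
  have My: "M *v y = z - x0"
  proof -
    have "(M *v y) $ i = (z - x0) $ i" for i
    proof -
      have "(M *v y) $ i = (\<Sum>x\<in>X - {x0}. (x $ i - x0 $ i) * u x)"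
        by (simp add: matrix_vector_mult_def M_def y_def reind)
      also have "\<dots> = (\<Sum>x\<in>X. (x $ i - x0 $ i) * u x)"
        using fin x0 by (simp add: sum.remove[of X x0])
      also have "\<dots> = (\<Sum>x\<in>X. u x *\<^sub>R x) $ i - x0 $ i * sum u X"
        by (simp add: algebra_simps sum_subtractf sum_distrib_left)
      finally show ?thesis using u by simp
    qed
    then show ?thesis by (simp add: vec_eq_iff)
  qed
  have Mint: "M $ i $ j \<in> \<int>" for i j by (simp add: M_def int fX x0)
  have yint: "y $ k \<in> \<int>" for k
  proof -
    \<comment> \<open>The replaced column is \<open>z - x0\<close>, so every entry is an
      integer.\<close>
    have "y $ k * det M = det (\<chi> i j. if j = k then (M *v y) $ i else M $ i $ j)"
      by (simp add: cramer_lemma)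
    also have "\<dots> \<in> \<int>"
      unfolding det_def
      by (intro Ints_sum Ints_mult Ints_prod) (auto simp: My Mint z(2) int x0)
    finally show ?thesis using \<open>\<bar>det M\<bar> = 1\<close>
      by (metis Ints_minus abs_eq_iff' minus_minus mult.right_neutral mult_minus1_right abs_one)
  qed
  have uint: "u x \<in> \<int>" if "x \<in> X - {x0}" for x
  proof -
    obtain j where "x = f j" using \<open>x \<in> X - {x0}\<close> f by (metis bij_betw_imp_surj_on imageE)
    then show ?thesis using yint[of j] by (simp add: y_def)
  qed
  show ?thesis
  proof (cases "\<exists>x\<in>X. u x = 1")
    case True
    then obtain x where x: "x \<in> X" "u x = 1" by blast
    then have "sum u (X - {x}) = 0" using u(2) fin by (simp add: sum.remove[of X x])
    then have "\<forall>w\<in>X - {x}. u w = 0" using u(1) fin by (subst (asm) sum_nonneg_eq_0_iff) auto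
    then have "z = x" using u(3) x fin by (simp add: sum.remove[of X x])
    then show ?thesis using x by simp
  next
    case False
    \<comment> \<open>Integrality is known away from \<open>x0\<close>: these weights are integers
      in [0, 1] other than 1, so \<open>x0\<close> carries the whole weight.\<close>
    have "u x = 0" if x: "x \<in> X - {x0}" for x
    proof -
      have "u x \<le> 1" using u that member_le_sum[of x X u] fin by auto
      moreover obtain n :: int where "u x = n" using uint[OF x] by (auto elim: Ints_cases)
      ultimately show ?thesis using False u(1) that
        by (metis DiffD1 antisym_conv2 of_int_0_le_iff of_int_le_1_iff int_one_le_iff_zero_less of_int_eq_0_iff order_antisym_conv of_int_1)
    qed
    then have "u x0 = 1" using u(2) x0 fin by (simp add: sum.remove[of X x0])
    then show ?thesis using False x0 by blast
  qed
qed

text \<open>The volume 1/6 is the unimodular one, so the four vertices are the only lattice points.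
  This will bound the number of terms that are maximal at one point.\<close>

lemma unimodular_tetrahedron_lattice_points:
  assumes T: "lattice_tetrahedron T" "measure lebesgue T = 1 / 6"
    and S: "S \<subseteq> T" "\<And>v i. v \<in> S \<Longrightarrow> v $ i \<in> \<int>"
  shows "finite S \<and> card S \<le> 4 \<and> (\<forall>v\<in>S. v extreme_point_of T)"
proof -
  obtain X where X: "\<not> affine_dependent X" "int (card X) = 3 + 1" "T = convex hull X"
    using T(1) by (auto simp: lattice_tetrahedron_def simplex)
  have fin: "finite X" using X(1) aff_independent_finite by blast
  have ext: "v extreme_point_of T \<longleftrightarrow> v \<in> X" for v
    using X by (simp add: extreme_point_of_convex_hull_affine_independent)
  have "closed T" using X fin by (simp add: compact_imp_closed finite_imp_compact_convex_hull)
  then have "measure lebesgue T = measure lborel T" by (simp add: measure_completion borel_closed)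
  then have vol: "measure lborel (convex hull X) = 1 / fact CARD(3)"
    using T(2) X by (simp add: fact_numeral)
  have "S \<subseteq> X"
  proof
    fix z assume "z \<in> S"
    then show "z \<in> X"
      using lattice_point_of_unimodular_simplex[OF fin _ _ vol, of z] X(2,3) S T(1) ext
      by (auto simp: lattice_tetrahedron_def)
  qed
  then show ?thesis using ext fin X(2) card_mono[of X S] by (auto intro: finite_subset)
qed

section \<open>Homogeneous exponents in degree 2\<close>

text \<open>The truncated subtraction is harmless for exponents of degree at most 2.\<close>

definition hexpo :: "nat ^ 3 \<Rightarrow> nat \<Rightarrow> nat" where
  "hexpo a i = (if i = 1 then a $ 1 else if i = 2 then a $ 2 else if i = 3 then a $ 3
     else 2 - (a $ 1 + a $ 2 + a $ 3))"

text \<open>A half-space is convex, so testing the four vertices suffices.\<close>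

lemma Gamma_simplex_halfspace:
  "Gamma_simplex d \<subseteq> {x. w \<bullet> x \<le> r} \<longleftrightarrow>
     0 \<le> r \<and> w $ 1 * real d \<le> r \<and> w $ 2 * real d \<le> r \<and> w $ 3 * real d \<le> r"
  unfolding Gamma_simplex_def subset_hull[of convex, OF convex_halfspace_le]
  by (simp add: inner_vec_def sum_3)

lemma newton_polytope_halfspace:
  "newton_polytope A \<subseteq> {x. w \<bullet> x \<le> r} \<longleftrightarrow> (\<forall>a\<in>A. w \<bullet> expo a \<le> r)"
  by (auto simp add: newton_polytope_def convex_halfspace_le subset_hull)

lemma degree_sum_le:
  assumes "has_degree A 2" "a \<in> A"
  shows "a $ 1 + a $ 2 + a $ 3 \<le> 2"
proof -
  have "\<forall>a\<in>A. vector [1, 1, 1] \<bullet> expo a \<le> 2"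
    using assms(1) unfolding has_degree_def newton_polytope_halfspace[symmetric]
    by (simp add: Gamma_simplex_halfspace)
  then have "vector [1, 1, 1] \<bullet> expo a \<le> 2" using assms(2) by blast
  then show ?thesis by (simp add: expo_def inner_vec_def sum_3)
qed

text \<open>This makes the four directions symmetric: along \<open>omega i\<close> a term has slope
  \<open>- hexpo a i\<close>, up to a summand common to all terms.\<close>

lemma expo_inner_omega:
  assumes "has_degree A 2" "a \<in> A" "i \<in> {1, 2, 3, 4}"
  shows "expo a \<bullet> omega i = (if i = 4 then 2 else 0) - real (hexpo a i)"
  using degree_sum_le[OF assms(1,2)] assms(3)
  by (auto simp: expo_def omega_def hexpo_def inner_vec_def sum_3)

text \<open>If \<open>hexpo c i\<close> were at most 1 for every exponent \<open>c\<close>, a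
  half-space would contain the Newton polytope but miss a vertex of
  \<open>Gamma_simplex 2\<close>.\<close>

lemma degree_vertex:
  assumes "has_degree A 2" "i \<in> {1, 2, 3, 4}"
  obtains c where "c \<in> A" "hexpo c i = 2"
proof -
  have eq: "newton_polytope A = Gamma_simplex 2" using assms(1) by (simp add: has_degree_def)
  have "\<not> newton_polytope A \<subseteq> {x. (- omega i) \<bullet> x \<le> (if i = 4 then -1 else 1)}"
    using assms(2) unfolding eq Gamma_simplex_halfspace by (auto simp: omega_def)
  then obtain c where c: "c \<in> A" "(- omega i) \<bullet> expo c > (if i = 4 then -1 else 1)"
    unfolding newton_polytope_halfspace by fastforce
  then have "real (hexpo c i) > 1"
    using expo_inner_omega[OF assms(1) c(1) assms(2)] by (auto simp: inner_commute split: if_splits)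
  moreover have "hexpo c i \<le> 2"
    using degree_sum_le[OF assms(1) c(1)] by (auto simp: hexpo_def)
  ultimately show ?thesis using that c by force
qed

section \<open>Relations among the four directions\<close>

lemma perm4_distinct: "{i, j, k, m} = {1, 2, 3, 4 :: nat} \<Longrightarrow> distinct [i, j, k, m]"
  by (rule card_distinct) (simp only: list.set, simp)

lemma sum_perm4:
  fixes f :: "nat \<Rightarrow> 'a :: comm_monoid_add"
  assumes "{i, j, k, m} = {1, 2, 3, 4}"
  shows "f i + (f j + (f k + f m)) = f 1 + (f 2 + (f 3 + f 4))"
proof -
  have "sum f {i, j, k, m} = sum f {1, 2, 3, 4}" using assms by simp
  then show ?thesis using perm4_distinct[OF assms] by simp
qed

lemma hexpo_sum:
  assumes "has_degree A 2" "a \<in> A" "{i, j, k, m} = {1, 2, 3, 4}"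
  shows "hexpo a i + (hexpo a j + (hexpo a k + hexpo a m)) = 2"
  unfolding sum_perm4[OF assms(3), of "hexpo a"]
  using degree_sum_le[OF assms(1,2)] by (simp add: hexpo_def)

lemma omega_sum:
  assumes "{i, j, k, m} = {1, 2, 3, 4}"
  shows "omega i + (omega j + (omega k + omega m)) = 0"
  unfolding sum_perm4[OF assms, of omega]
  by (simp add: omega_def vec_eq_iff forall_3)

text \<open>Three of the directions are linearly independent and all four sum to zero, so up to
  scaling there is no other relation. The function \<open>f\<close> carries the coefficients back to
  the standard order.\<close>

lemma omega_dependence:
  assumes perm: "{i, j, k, m} = {1, 2, 3, 4}"
    and eq: "x *\<^sub>R omega i + (y *\<^sub>R omega j + (z *\<^sub>R omega k + w *\<^sub>R omega m)) = 0"
  shows "x = y \<and> y = z \<and> z = w"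
proof -
  define f where "f n = (if n = i then x else if n = j then y else if n = k then z else w)" for n
  have f: "f i = x" "f j = y" "f k = z" "f m = w"
    using perm4_distinct[OF perm] by (auto simp: f_def)
  have "f 1 *\<^sub>R omega 1 + (f 2 *\<^sub>R omega 2 + (f 3 *\<^sub>R omega 3 + f 4 *\<^sub>R omega 4)) = 0"
    using sum_perm4[OF perm, of "\<lambda>n. f n *\<^sub>R omega n"] eq f by simp
  then have "f 1 = f 4 \<and> f 2 = f 4 \<and> f 3 = f 4"
    by (simp add: omega_def vec_eq_iff forall_3)
  then have "\<forall>n\<in>{1, 2, 3, 4}. f n = f 4" by simp
  then have "\<forall>n\<in>{i, j, k, m}. f n = f 4" unfolding perm .
  then show ?thesis using f by simp
qed

text \<open>Translated to \<open>p\<close>, such cones contain the two halves of a line of one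
  ruling; they serve to tell the rulings apart.\<close>

definition cone2 :: "nat \<Rightarrow> nat \<Rightarrow> (real ^ 3) set" where
  "cone2 i k = {x *\<^sub>R omega i + y *\<^sub>R omega k | x y. 0 \<le> x \<and> 0 \<le> y}"

text \<open>Membership would give a linear relation among the four directions with one coefficient 0
  and another equal to \<open>r\<close>.\<close>

lemma diagonal_notin_cone2:
  assumes perm: "{i, j, k, m} = {1, 2, 3, 4}" and r: "r > 0"
  shows "r *\<^sub>R (omega i + omega k) \<notin> cone2 i m" "r *\<^sub>R (omega i + omega k) \<notin> cone2 j k"
proof -
  show "r *\<^sub>R (omega i + omega k) \<notin> cone2 i m"
  proof
    assume "r *\<^sub>R (omega i + omega k) \<in> cone2 i m"
    then obtain x y where "r *\<^sub>R (omega i + omega k) = x *\<^sub>R omega i + y *\<^sub>R omega m"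
      by (auto simp: cone2_def)
    moreover have "(r - x) *\<^sub>R omega i + (0 *\<^sub>R omega j + (r *\<^sub>R omega k + (- y) *\<^sub>R omega m))
        = r *\<^sub>R (omega i + omega k) - (x *\<^sub>R omega i + y *\<^sub>R omega m)"
      by (simp add: algebra_simps)
    ultimately have "(r - x) *\<^sub>R omega i + (0 *\<^sub>R omega j + (r *\<^sub>R omega k + (- y) *\<^sub>R omega m)) = 0"
      by simp
    from omega_dependence[OF perm this] r show False by linarith
  qed
  show "r *\<^sub>R (omega i + omega k) \<notin> cone2 j k"
  proof
    assume "r *\<^sub>R (omega i + omega k) \<in> cone2 j k"
    then obtain x y where "r *\<^sub>R (omega i + omega k) = x *\<^sub>R omega j + y *\<^sub>R omega k"
      by (auto simp: cone2_def)
    moreover have "r *\<^sub>R omega i + ((- x) *\<^sub>R omega j + ((r - y) *\<^sub>R omega k + 0 *\<^sub>R omega m))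
        = r *\<^sub>R (omega i + omega k) - (x *\<^sub>R omega j + y *\<^sub>R omega k)"
      by (simp add: algebra_simps)
    ultimately have "r *\<^sub>R omega i + ((- x) *\<^sub>R omega j + ((r - y) *\<^sub>R omega k + 0 *\<^sub>R omega m)) = 0"
      by simp
    from omega_dependence[OF perm this] r show False by linarith
  qed
qed

section \<open>Construction of a line of a ruling\<close>

lemma trop_surfaceI:
  assumes "finite A" "a \<in> A" "b \<in> A" "a \<noteq> b" "trop_term l a x = trop_term l b x"
    and "\<And>c. c \<in> A \<Longrightarrow> trop_term l c x \<le> trop_term l a x"
  shows "x \<in> trop_surface A l"
proof -
  have "trop_poly A l x = trop_term l a x"
    unfolding trop_poly_def using assms by (intro Max_eqI) auto
  then show ?thesis using assms unfolding trop_surface_def by fastforce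
qed

text \<open>
  Moving from \<open>p\<close> in direction \<open>omega i + omega k\<close>, the two leading terms \<open>a\<close> and \<open>b\<close> stay
  maximal until a term of degree 0 in the variables \<open>i\<close> and \<open>k\<close> catches up, at distance \<open>s\<close>;
  from there on one of the leading terms ties with that term along both rays.
\<close>

lemma half_line:
  assumes fin: "finite A" and deg: "has_degree A 2" and perm: "{i, j, k, m} = {1, 2, 3, 4}"
    and a: "a \<in> A" "trop_term l a p = M" "hexpo a i = 1" "hexpo a k = 0"
    and b: "b \<in> A" "trop_term l b p = M" "hexpo b i = 0" "hexpo b k = 1"
    and M: "\<And>c. c \<in> A \<Longrightarrow> trop_term l c p \<le> M"
  obtains s where "s \<ge> 0"
    and "\<And>x y. x \<ge> 0 \<Longrightarrow> y \<ge> 0 \<Longrightarrow> x = y \<and> x \<le> s \<or> min x y = s \<Longrightarrow>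
           p + (x *\<^sub>R omega i + y *\<^sub>R omega k) \<in> trop_surface A l"
    and "s = 0 \<Longrightarrow> \<exists>c\<in>A. trop_term l c p = M \<and> hexpo c i = 0 \<and> hexpo c k = 0"
proof -
  have ik: "i \<in> {1, 2, 3, 4}" "j \<in> {1, 2, 3, 4}" "k \<in> {1, 2, 3, 4}" using perm by auto
  define N where "N = {c \<in> A. hexpo c i = 0 \<and> hexpo c k = 0}"
  \<comment> \<open>The square of the variable \<open>j\<close> lies in \<open>N\<close>, so a
    maximum over \<open>N\<close> exists.\<close>
  obtain v where v: "v \<in> A" "hexpo v j = 2" using degree_vertex[OF deg ik(2)] .
  then have "v \<in> N" using hexpo_sum[OF deg v(1) perm] by (simp add: N_def)
  moreover have "finite N" using fin by (simp add: N_def)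
  ultimately obtain d where d: "d \<in> N" "\<And>c. c \<in> N \<Longrightarrow> trop_term l c p \<le> trop_term l d p"
    using Max_in[of "(\<lambda>c. trop_term l c p) ` N"] Max_ge[of "(\<lambda>c. trop_term l c p) ` N"]
    by fastforce
  define s where "s = M - trop_term l d p"
  have dA: "d \<in> A" "hexpo d i = 0" "hexpo d k = 0" using d by (auto simp: N_def)
  have "p + (x *\<^sub>R omega i + y *\<^sub>R omega k) \<in> trop_surface A l"
    if xy: "x \<ge> 0" "y \<ge> 0" "x = y \<and> x \<le> s \<or> min x y = s" for x y
  proof -
    define q where "q = p + (x *\<^sub>R omega i + y *\<^sub>R omega k)"
    define K where "K = x * (if i = 4 then 2 else 0) + y * (if k = 4 then 2 else 0)"
    have T: "trop_term l c q = trop_term l c p + K - x * hexpo c i - y * hexpo c k"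
      if "c \<in> A" for c
      unfolding q_def K_def trop_term_def inner_add_right inner_scaleR_right
        expo_inner_omega[OF deg that ik(1)] expo_inner_omega[OF deg that ik(3)]
      by (simp add: algebra_simps)
    have Ta: "trop_term l a q = M + K - x" and Tb: "trop_term l b q = M + K - y"
      and Td: "trop_term l d q = M + K - s"
      using T a b dA by (auto simp: s_def)
    \<comment> \<open>Apart from the common shift \<open>K\<close>, a term in \<open>N\<close> stays
      where it started, at least \<open>s\<close> below \<open>M\<close>; any other term drops by at
      least \<open>x\<close> or \<open>y\<close>.\<close>
    have bound: "trop_term l c q \<le> M + K - min (min x y) s" if c: "c \<in> A" for c
    proof (cases "c \<in> N")
      case True
      then show ?thesis using d(2)[OF True] T[OF c] by (simp add: N_def s_def)
    next
      case False
      then consider "hexpo c i \<ge> 1" | "hexpo c k \<ge> 1" using c by (auto simp: N_def)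
      then show ?thesis
      proof cases
        case 1
        then have "x * 1 \<le> x * hexpo c i" using xy by (intro mult_left_mono) auto
        moreover have "0 \<le> y * hexpo c k" using xy by simp
        ultimately show ?thesis using T[OF c] M[OF c] by simp
      next
        case 2
        then have "y * 1 \<le> y * hexpo c k" using xy by (intro mult_left_mono) auto
        moreover have "0 \<le> x * hexpo c i" using xy by simp
        ultimately show ?thesis using T[OF c] M[OF c] by simp
      qed
    qed
    have ne: "a \<noteq> b" "a \<noteq> d" "b \<noteq> d" using a b dA by auto
    \<comment> \<open>On the diagonal \<open>a\<close> and \<open>b\<close> tie; beyond it
      \<open>a\<close> ties with \<open>d\<close> on the ray along \<open>omega k\<close>, and
      \<open>b\<close> with \<open>d\<close> on the ray along \<open>omega i\<close>.\<close>
    consider "x = y" "x \<le> s" | "x = s" "s \<le> y" | "y = s" "s \<le> x" using xy(3) by linarith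
    then have "q \<in> trop_surface A l"
    proof cases
      case 1
      then show ?thesis
        using trop_surfaceI[OF fin a(1) b(1) ne(1), of l q] Ta Tb bound by auto
    next
      case 2
      then show ?thesis
        using trop_surfaceI[OF fin a(1) dA(1) ne(2), of l q] Ta Td bound by auto
    next
      case 3
      then show ?thesis
        using trop_surfaceI[OF fin b(1) dA(1) ne(3), of l q] Tb Td bound by auto
    qed
    then show ?thesis by (simp add: q_def)
  qed
  moreover have "s \<ge> 0" using M[OF dA(1)] by (simp add: s_def)
  moreover have "s = 0 \<Longrightarrow> \<exists>c\<in>A. trop_term l c p = M \<and> hexpo c i = 0 \<and> hexpo c k = 0"
    using dA by (auto simp: s_def)
  ultimately show ?thesis using that by blast
qed

text \<open>The four directions sum to zero, so the half-lines for \<open>i\<close>,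
  \<open>k\<close> and for \<open>j\<close>, \<open>m\<close> start oppositely and their segments
  join at \<open>p\<close>. The last two conclusions serve to separate the rulings: either the line
  continues along a diagonal from \<open>p\<close>, or further maximal terms stop it there on both
  sides.\<close>

lemma ruling_line:
  assumes fin: "finite A" and deg: "has_degree A 2" and perm: "{i, j, k, m} = {1, 2, 3, 4}"
    and a: "a \<in> A" "trop_term l a p = M" "hexpo a i = 1" "hexpo a j = 1"
    and b: "b \<in> A" "trop_term l b p = M" "hexpo b k = 1" "hexpo b m = 1"
    and M: "\<And>c. c \<in> A \<Longrightarrow> trop_term l c p \<le> M"
  obtains L where "tropical_line L" "L \<subseteq> trop_surface A l" "p \<in> L"
    and "L \<subseteq> (+) p ` (cone2 i k \<union> cone2 j m)"
    and "(\<exists>r>0. p + r *\<^sub>R (omega i + omega k) \<in> L) \<or> (\<exists>r>0. p + r *\<^sub>R (omega j + omega m) \<in> L) \<or>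
         (\<exists>c\<in>A. trop_term l c p = M \<and> hexpo c i = 0 \<and> hexpo c k = 0) \<and>
         (\<exists>c\<in>A. trop_term l c p = M \<and> hexpo c j = 0 \<and> hexpo c m = 0)"
proof -
  have perm': "{j, i, m, k} = {1, 2, 3, 4}" using perm by (simp add: insert_commute)
  \<comment> \<open>The degree is 2, so \<open>a\<close> and \<open>b\<close> involve no further
    variables.\<close>
  have 0: "hexpo a k = 0" "hexpo a m = 0" "hexpo b i = 0" "hexpo b j = 0"
    using hexpo_sum[OF deg a(1) perm] hexpo_sum[OF deg b(1) perm] a b by auto
  obtain s where s: "s \<ge> 0"
    "\<And>x y. x \<ge> 0 \<Longrightarrow> y \<ge> 0 \<Longrightarrow> x = y \<and> x \<le> s \<or> min x y = s \<Longrightarrow>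
       p + (x *\<^sub>R omega i + y *\<^sub>R omega k) \<in> trop_surface A l"
    "s = 0 \<Longrightarrow> \<exists>c\<in>A. trop_term l c p = M \<and> hexpo c i = 0 \<and> hexpo c k = 0"
    using half_line[OF fin deg perm a(1,2,3) 0(1) b(1,2) 0(3) b(3) M] by blast
  obtain t where t: "t \<ge> 0"
    "\<And>x y. x \<ge> 0 \<Longrightarrow> y \<ge> 0 \<Longrightarrow> x = y \<and> x \<le> t \<or> min x y = t \<Longrightarrow>
       p + (x *\<^sub>R omega j + y *\<^sub>R omega m) \<in> trop_surface A l"
    "t = 0 \<Longrightarrow> \<exists>c\<in>A. trop_term l c p = M \<and> hexpo c j = 0 \<and> hexpo c m = 0"
    using half_line[OF fin deg perm' a(1,2,4) 0(2) b(1,2) 0(4) b(4) M] by blast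
  \<comment> \<open>Parameters with \<open>x = y\<close> trace the segment from \<open>p\<close>,
    those with \<open>min x y = s\<close> the two rays at its end.\<close>
  define H1 where "H1 = {p + (x *\<^sub>R omega i + y *\<^sub>R omega k) | x y.
    x \<ge> 0 \<and> y \<ge> 0 \<and> (x = y \<and> x \<le> s \<or> min x y = s)}"
  define H2 where "H2 = {p + (x *\<^sub>R omega j + y *\<^sub>R omega m) | x y.
    x \<ge> 0 \<and> y \<ge> 0 \<and> (x = y \<and> x \<le> t \<or> min x y = t)}"
  define u where "u = p + s *\<^sub>R (omega i + omega k)"
  define v where "v = p + t *\<^sub>R (omega j + omega m)"
  define L where "L = closed_segment v u \<union> ray v (omega j) \<union> ray v (omega m)
    \<union> ray u (omega i) \<union> ray u (omega k)"
  have opp: "omega j + omega m = - (omega i + omega k)"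
    using omega_sum[OF perm] by (simp add: eq_neg_iff_add_eq_0 algebra_simps)
  have uv: "u = v + (t + s) *\<^sub>R (omega i + omega k)"
    unfolding u_def v_def opp by (simp add: algebra_simps)
  have H1I: "p + (x *\<^sub>R omega i + y *\<^sub>R omega k) \<in> H1"
    if "x \<ge> 0" "y \<ge> 0" "x = y \<and> x \<le> s \<or> min x y = s" for x y
    using that unfolding H1_def by blast
  have H2I: "p + (x *\<^sub>R omega j + y *\<^sub>R omega m) \<in> H2"
    if "x \<ge> 0" "y \<ge> 0" "x = y \<and> x \<le> t \<or> min x y = t" for x y
    using that unfolding H2_def by blast
  have seg: "p + r *\<^sub>R (omega i + omega k) \<in> H1 \<union> H2" if "- t \<le> r" "r \<le> s" for r
  proof (cases "r \<ge> 0")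
    case True
    then show ?thesis using H1I[of r r] that by (simp add: scaleR_add_right)
  next
    case False
    have "r *\<^sub>R (omega i + omega k) = (- r) *\<^sub>R (omega j + omega m)"
      unfolding opp by (simp add: algebra_simps)
    then show ?thesis using H2I[of "- r" "- r"] that False by (simp add: scaleR_add_right)
  qed
  \<comment> \<open>Points are described by their signed position \<open>r\<close> relative to
    \<open>p\<close>. Recovering the segment parameter divides by \<open>t + s\<close>, so the
    degenerate case is treated apart.\<close>
  have seg_iff: "x \<in> closed_segment v u \<longleftrightarrow> (\<exists>r. - t \<le> r \<and> r \<le> s \<and> x = p + r *\<^sub>R (omega i + omega k))"
    for x
  proof
    assume "x \<in> closed_segment v u"
    then obtain e where e: "0 \<le> e" "e \<le> 1" "x = v + e *\<^sub>R (u - v)"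
      by (auto simp: in_segment algebra_simps)
    have "x = p + (- t + e * (t + s)) *\<^sub>R (omega i + omega k)"
      unfolding e(3) uv v_def opp by (simp add: algebra_simps)
    moreover have "e * (t + s) \<le> 1 * (t + s)" using e s t by (intro mult_right_mono) auto
    moreover have "e * (t + s) \<ge> 0" using e s t by simp
    ultimately show "\<exists>r. - t \<le> r \<and> r \<le> s \<and> x = p + r *\<^sub>R (omega i + omega k)"
      by (intro exI[of _ "- t + e * (t + s)"]) auto
  next
    assume "\<exists>r. - t \<le> r \<and> r \<le> s \<and> x = p + r *\<^sub>R (omega i + omega k)"
    then obtain r where r: "- t \<le> r" "r \<le> s" "x = p + r *\<^sub>R (omega i + omega k)" by blast
    show "x \<in> closed_segment v u"
    proof (cases "t + s = 0")
      case True
      then have "t = 0" "s = 0" "r = 0" using s t r by auto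
      then show ?thesis using r by (simp add: u_def v_def)
    next
      case False
      define e where "e = (r + t) / (t + s)"
      have e: "0 \<le> e" "e \<le> 1" "e * (t + s) = r + t"
        using False s t r by (auto simp: e_def field_simps)
      have "x = v + (e * (t + s)) *\<^sub>R (omega i + omega k)"
        unfolding r(3) e(3) v_def opp by (simp add: algebra_simps)
      also have "\<dots> = (1 - e) *\<^sub>R v + e *\<^sub>R u" unfolding uv by (simp add: algebra_simps)
      finally show ?thesis using e by (auto simp: in_segment)
    qed
  qed
  have rays: "ray v (omega j) \<subseteq> H2" "ray v (omega m) \<subseteq> H2" "ray u (omega i) \<subseteq> H1" "ray u (omega k) \<subseteq> H1"
  proof -
    have "v + e *\<^sub>R omega j = p + ((t + e) *\<^sub>R omega j + t *\<^sub>R omega m)"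
      "v + e *\<^sub>R omega m = p + (t *\<^sub>R omega j + (t + e) *\<^sub>R omega m)"
      "u + e *\<^sub>R omega i = p + ((s + e) *\<^sub>R omega i + s *\<^sub>R omega k)"
      "u + e *\<^sub>R omega k = p + (s *\<^sub>R omega i + (s + e) *\<^sub>R omega k)" for e
      by (simp_all add: u_def v_def algebra_simps)
    then show "ray v (omega j) \<subseteq> H2" "ray v (omega m) \<subseteq> H2" "ray u (omega i) \<subseteq> H1" "ray u (omega k) \<subseteq> H1"
      using s(1) t(1) by (auto simp: ray_def intro!: H1I H2I)
  qed
  have LH: "L \<subseteq> H1 \<union> H2"
  proof -
    have "closed_segment v u \<subseteq> H1 \<union> H2"
    proof
      fix x assume "x \<in> closed_segment v u"
      then obtain r where "- t \<le> r" "r \<le> s" "x = p + r *\<^sub>R (omega i + omega k)"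
        using seg_iff by blast
      then show "x \<in> H1 \<union> H2" using seg[of r] by simp
    qed
    then show ?thesis unfolding L_def using rays by blast
  qed
  have "tropical_line L"
    unfolding tropical_line_def
  proof (intro exI conjI)
    show "{j, m} \<union> {i, k} = {1, 2, 3, 4}" using perm by auto
    show "{j, m} \<inter> {i, k} = {}" using perm4_distinct[OF perm] by auto
    show "0 \<le> t + s" using s t by simp
    show "u = v + (t + s) *\<^sub>R (omega i + omega k)" by (fact uv)
  qed (simp add: L_def)
  moreover have "L \<subseteq> trop_surface A l"
    using LH s(2) t(2) by (auto simp: H1_def H2_def)
  moreover have "p \<in> L" using seg_iff[of p] s t unfolding L_def by (auto intro: exI[of _ 0])
  moreover have "L \<subseteq> (+) p ` (cone2 i k \<union> cone2 j m)"
  proof -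
    have "H1 \<subseteq> (+) p ` cone2 i k" "H2 \<subseteq> (+) p ` cone2 j m"
      unfolding H1_def H2_def cone2_def by blast+
    then show ?thesis using LH by blast
  qed
  moreover have "(\<exists>r>0. p + r *\<^sub>R (omega i + omega k) \<in> L) \<or> (\<exists>r>0. p + r *\<^sub>R (omega j + omega m) \<in> L) \<or>
         (\<exists>c\<in>A. trop_term l c p = M \<and> hexpo c i = 0 \<and> hexpo c k = 0) \<and>
         (\<exists>c\<in>A. trop_term l c p = M \<and> hexpo c j = 0 \<and> hexpo c m = 0)"
  proof -
    consider "s > 0" | "t > 0" | "s = 0" "t = 0" using s t by linarith
    then show ?thesis
    proof cases
      case 1
      have "p + s *\<^sub>R (omega i + omega k) \<in> L" unfolding L_def u_def[symmetric] by simp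
      then show ?thesis using 1 by blast
    next
      case 2
      have "p + t *\<^sub>R (omega j + omega m) \<in> L" unfolding L_def v_def[symmetric] by simp
      then show ?thesis using 2 by blast
    next
      case 3
      then show ?thesis using s(3) t(3) by blast
    qed
  qed
  ultimately show ?thesis using that by blast
qed

section \<open>Leading terms and vertices of cells\<close>

lemma inj_expo: "inj expo"
  by (auto simp: inj_def expo_def vec_eq_iff)

lemma inner_lifted: "(u, t) \<bullet> (expo a, l a) = u \<bullet> expo a + t * l a"
  by (simp add: inner_prod_def)

text \<open>The normal \<open>(p, 1)\<close> cuts out an upper face whose projection contains the
  exponents of all terms maximal at \<open>p\<close>. It lies in a maximal cell, a unimodular
  tetrahedron, whose only lattice points are its vertices.\<close>

lemma smooth_leading_terms:
  fixes p :: "real ^ 3"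
  assumes fin: "finite A" and ne: "A \<noteq> {}" and elem: "elementary_subdivision (Subdiv A l)"
  defines "S \<equiv> {a \<in> A. \<forall>c\<in>A. trop_term l c p \<le> trop_term l a p}"
  obtains T where "card S \<le> 4" "\<And>a. a \<in> S \<Longrightarrow> expo a extreme_point_of T"
proof -
  define P where "P = lifted_polytope A l"
  obtain d where d: "d \<in> A" "\<And>c. c \<in> A \<Longrightarrow> trop_term l c p \<le> trop_term l d p"
    using Max_in[of "(\<lambda>c. trop_term l c p) ` A"] Max_ge[of "(\<lambda>c. trop_term l c p) ` A"] fin ne
    by fastforce
  define M where "M = trop_term l d p"
  have lift: "(p, 1) \<bullet> (expo a, l a) = trop_term l a p" for a
    by (simp add: inner_lifted trop_term_def inner_commute)
  have le: "P \<subseteq> {y. (p, 1) \<bullet> y \<le> M}"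
    unfolding P_def lifted_polytope_def
    by (rule hull_minimal) (use d(2) lift M_def convex_halfspace_le in auto)
  define F where "F = P \<inter> {y. (p, 1) \<bullet> y = M}"
  have inP: "(expo a, l a) \<in> P" if "a \<in> A" for a
    using that unfolding P_def lifted_polytope_def by (intro hull_inc) auto
  have SF: "expo ` S \<subseteq> fst ` F"
  proof
    fix v assume "v \<in> expo ` S"
    then obtain a where a: "v = expo a" "a \<in> S" by blast
    then have "trop_term l a p = M" using d by (auto simp: S_def M_def intro: antisym)
    then have "(expo a, l a) \<in> F" using inP[of a] a lift by (auto simp: F_def S_def)
    then show "v \<in> fst ` F" using a by force
  qed
  have "d \<in> S" using d by (auto simp: S_def)
  then have "F \<noteq> {}" using SF by blast
  have poly: "polytope P" using fin by (auto simp: P_def lifted_polytope_def polytope_def)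
  have "F face_of P"
    unfolding F_def using poly le
    by (intro face_of_Int_supporting_hyperplane_le) (auto simp: polytope_imp_convex)
  with \<open>F \<noteq> {}\<close> le have "upper_face F P"
    unfolding upper_face_def F_def using zero_less_one by blast
  then have D: "fst ` F \<in> Subdiv A l" by (auto simp: Subdiv_def P_def)
  \<comment> \<open>Only maximal cells are known to be tetrahedra; finiteness of the set of faces
    provides one above the projected face.\<close>
  have "Subdiv A l \<subseteq> (`) fst ` {F. F face_of P}" by (auto simp: Subdiv_def upper_face_def P_def)
  then have "finite (Subdiv A l)" using finite_polytope_faces[OF poly] by (meson finite_imageI finite_subset)
  then obtain T where T: "T \<in> Subdiv A l" "fst ` F \<subseteq> T" "\<forall>D'\<in>Subdiv A l. T \<subseteq> D' \<longrightarrow> T = D'"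
    using finite_has_maximal2[OF _ D] by auto
  then have tet: "lattice_tetrahedron T" "measure lebesgue T = 1 / 6"
    using elem unfolding elementary_subdivision_def by metis+
  have "expo ` S \<subseteq> T" using SF T by blast
  moreover have "v $ i \<in> \<int>" if "v \<in> expo ` S" for v i using that by (auto simp: expo_def)
  ultimately have "card (expo ` S) \<le> 4 \<and> (\<forall>v\<in>expo ` S. v extreme_point_of T)"
    using unimodular_tetrahedron_lattice_points[OF tet] by blast
  moreover have "card (expo ` S) = card S" by (meson card_image inj_expo inj_on_subset subset_UNIV)
  ultimately show ?thesis using that by auto
qed

lemma extreme_point_not_midpoint:
  assumes "b extreme_point_of T" "c extreme_point_of T" "b \<noteq> c" "a extreme_point_of T"
  shows "2 *\<^sub>R a \<noteq> b + c"
proof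
  assume "2 *\<^sub>R a = b + c"
  then have "midpoint b c = (1 / 2) *\<^sub>R (2 *\<^sub>R a)" by (simp add: midpoint_def)
  then have "a = midpoint b c" by simp
  then have "a \<in> open_segment b c" using assms(3) by simp
  then show False using assms by (auto simp: extreme_point_of_def)
qed

text \<open>One of three distinct collinear points lies strictly between the other two.\<close>

lemma collinear_extreme_points:
  fixes a b c :: "'a :: euclidean_space"
  assumes "a extreme_point_of T" "b extreme_point_of T" "c extreme_point_of T"
    and "collinear {a, b, c}"
  shows "a = b \<or> b = c \<or> a = c"
proof (rule ccontr)
  assume "\<not> ?thesis"
  then have "a \<in> open_segment b c \<or> b \<in> open_segment c a \<or> c \<in> open_segment a b"
    using assms(4) by (auto simp: collinear_between_cases between_mem_segment open_segment_def)
  then show False using assms(1-3) by (auto simp: extreme_point_of_def)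
qed

text \<open>A face of the hull of a finite set is the hull of a subset, and projecting it gives the
  hull of the projected subset. By Krein-Milman the extreme points suffice, and they are among the
  projected generators.\<close>

lemma Subdiv_vertices:
  assumes fin: "finite A" and D: "D \<in> Subdiv A l"
  shows "D = convex hull (expo ` vertex_expos A D)"
proof -
  obtain F where F: "F face_of lifted_polytope A l" "D = fst ` F"
    using D by (auto simp: Subdiv_def upper_face_def)
  obtain s where s: "s \<subseteq> (\<lambda>a. (expo a, l a)) ` A" "F = convex hull s"
    by (rule face_of_convex_hull_subset[OF _ F(1)[unfolded lifted_polytope_def]])
      (simp add: fin finite_imp_compact)
  have D': "D = convex hull (fst ` s)"
    using F(2) s(2) by (simp add: convex_hull_linear_image linear_fst)
  have "finite (fst ` s)" using s(1) fin by (meson finite_imageI finite_subset)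
  then have "D = convex hull {x. x extreme_point_of D}"
    using Krein_Milman_Minkowski[of "convex hull (fst ` s)"]
    unfolding D' by (simp only: finite_imp_compact_convex_hull convex_convex_hull)
  moreover have "{x. x extreme_point_of D} = expo ` vertex_expos A D"
  proof
    show "{x. x extreme_point_of D} \<subseteq> expo ` vertex_expos A D"
    proof
      fix x assume "x \<in> {x. x extreme_point_of D}"
      then have x: "x extreme_point_of D" by simp
      then have "x \<in> fst ` s" unfolding D' by (rule extreme_point_of_convex_hull)
      then obtain a where "a \<in> A" "x = expo a" using s(1) by auto
      then show "x \<in> expo ` vertex_expos A D" using x by (simp add: vertex_expos_def)
    qed
  qed (auto simp: vertex_expos_def)
  ultimately show ?thesis by simp
qed

section \<open>The edge dual to the compact cell\<close>

text \<open>A linear form constant on \<open>C\<close> is constant on the plane spanned by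
  \<open>C\<close>, hence proportional to its normal. For terms that tie on \<open>C\<close> this
  makes the differences of their exponents parallel.\<close>

lemma aff_dim_two_normal:
  fixes C :: "(real ^ 3) set"
  assumes "aff_dim C = 2"
  obtains n where "\<And>w r. C \<subseteq> {x. w \<bullet> x = r} \<Longrightarrow> \<exists>c. w = c *\<^sub>R n"
proof -
  obtain n \<beta> where n: "n \<noteq> 0" "affine hull C = {x. n \<bullet> x = \<beta>}"
    using assms aff_dim_eq_hyperplane[of C] by auto
  have "\<exists>c. w = c *\<^sub>R n" if "C \<subseteq> {x. w \<bullet> x = r}" for w r
  proof -
    have hull: "affine hull C \<subseteq> {x. w \<bullet> x = r}"
      using that by (intro hull_minimal affine_hyperplane)
    \<comment> \<open>\<open>x0\<close> is the foot of the perpendicular from the origin and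
      \<open>y\<close> the part of \<open>w\<close> orthogonal to \<open>n\<close>. Both
      \<open>x0\<close> and \<open>x0 + y\<close> lie in the plane, which forces
      \<open>y = 0\<close>.\<close>
    define x0 where "x0 = (\<beta> / (n \<bullet> n)) *\<^sub>R n"
    define y where "y = w - ((w \<bullet> n) / (n \<bullet> n)) *\<^sub>R n"
    have ny: "n \<bullet> y = 0" using n by (simp add: y_def inner_diff_right inner_commute)
    have "x0 \<in> affine hull C" "x0 + y \<in> affine hull C"
      using n ny by (simp_all add: x0_def inner_add_right)
    then have "w \<bullet> x0 = r" "w \<bullet> (x0 + y) = r" using hull by blast+
    then have "w \<bullet> y = 0" by (simp add: inner_add_right)
    then have "y \<bullet> y = 0"
      using ny by (subst (1) y_def) (simp add: inner_diff_left)
    then have "w = ((w \<bullet> n) / (n \<bullet> n)) *\<^sub>R n" by (simp add: y_def)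
    then show ?thesis by blast
  qed
  then show ?thesis using that by blast
qed

text \<open>
  A compact 2-cell is dual to an edge that lies in no facet of the Newton polytope, as the cell
  dual to a face in the facet of exponents with vanishing \<open>i\<close>-th coordinate recedes in direction
  \<open>omega i\<close>. The coordinates of the two ends add up to 2 and are all positive in total.
\<close>

lemma compact_2cell_edge:
  assumes fin: "finite A" and deg: "has_degree A 2" and C: "compact_2cell A l C"
  obtains i j k m a b where "{i, j, k, m} = {1, 2, 3, 4}" "a \<in> A" "b \<in> A"
    "hexpo a i = 1" "hexpo a j = 1" "hexpo b k = 1" "hexpo b m = 1"
    "\<And>p. p \<in> C \<Longrightarrow> trop_term l a p = trop_term l b p"
    "\<And>p c. p \<in> C \<Longrightarrow> c \<in> A \<Longrightarrow> trop_term l c p \<le> trop_term l a p"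
proof -
  note concl = that
  obtain D where D: "C = dual_cell A l D" "D \<in> Subdiv A l" "aff_dim D \<ge> 1"
    and dim: "aff_dim C = 2" and cpt: "compact C"
    using C by (auto simp: compact_2cell_def surface_cells_def)
  define V where "V = vertex_expos A D"
  have VA: "V \<subseteq> A" by (auto simp: V_def vertex_expos_def)
  have ext: "expo a extreme_point_of D" if "a \<in> V" for a
    using that by (simp add: V_def vertex_expos_def)
  have eqV: "trop_term l a x = trop_term l b x" if "a \<in> V" "b \<in> V" "x \<in> C" for a b x
    using that unfolding D(1) dual_cell_def V_def by blast
  have geV: "trop_term l c x \<le> trop_term l a x" if "a \<in> V" "c \<in> A" "x \<in> C" for a c x
    using that unfolding D(1) dual_cell_def V_def by blast
  have "D = convex hull (expo ` V)" using Subdiv_vertices[OF fin D(2)] by (simp add: V_def)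
  have notsing: "\<not> V \<subseteq> {a}" for a
  proof
    assume "V \<subseteq> {a}"
    then have "expo ` V \<subseteq> {expo a}" by auto
    then have "D \<subseteq> {expo a}"
      using \<open>D = convex hull (expo ` V)\<close> hull_mono[of "expo ` V" "{expo a}" convex] by simp
    then have "aff_dim D \<le> aff_dim {expo a}" by (rule aff_dim_subset)
    then show False using D(3) by simp
  qed
  then obtain a where a: "a \<in> V" by blast
  obtain b where b: "b \<in> V" "a \<noteq> b" using notsing[of a] by blast
  obtain n where n: "\<And>w r. C \<subseteq> {x. w \<bullet> x = r} \<Longrightarrow> \<exists>c. w = c *\<^sub>R n"
    using aff_dim_two_normal[OF dim] by blast
  have par: "\<exists>c. expo v - expo w = c *\<^sub>R n" if "v \<in> V" "w \<in> V" for v w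
  proof (rule n)
    show "C \<subseteq> {x. (expo v - expo w) \<bullet> x = l w - l v}"
    proof
      fix x assume "x \<in> C"
      then show "x \<in> {x. (expo v - expo w) \<bullet> x = l w - l v}"
        using eqV[OF that, of x] by (simp add: trop_term_def inner_diff_left)
    qed
  qed
  \<comment> \<open>The exponents of \<open>V\<close> differ by multiples of \<open>n\<close>, so
    they are collinear, and three distinct extreme points never are.\<close>
  have V: "V = {a, b}"
  proof (rule ccontr)
    assume "V \<noteq> {a, b}"
    then obtain c where c: "c \<in> V" "c \<noteq> a" "c \<noteq> b" using a b by blast
    have "collinear (expo ` V)" unfolding collinear_def using par by blast
    then have "collinear {expo a, expo b, expo c}"
      using a b c by (auto intro: collinear_subset)
    then show False
      using collinear_extreme_points[OF ext[OF a] ext[OF b(1)] ext[OF c(1)]] b(2) c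
      by (simp add: inj_eq[OF inj_expo])
  qed
  have pos: "hexpo a i + hexpo b i \<ge> 1" if i: "i \<in> {1, 2, 3, 4}" for i
  proof (rule ccontr)
    assume "\<not> hexpo a i + hexpo b i \<ge> 1"
    then have 0: "hexpo v i = 0" if "v \<in> V" for v using that V by auto
    have "C \<noteq> {}" using dim by auto
    then obtain x where x: "x \<in> C" by blast
    define \<kappa> where "\<kappa> = (if i = 4 then 2 else 0 :: real)"
    have T: "trop_term l c (x + t *\<^sub>R omega i) = trop_term l c x + t * \<kappa> - t * hexpo c i" if "c \<in> A" for c t
      unfolding trop_term_def inner_add_right inner_scaleR_right expo_inner_omega[OF deg that i] \<kappa>_def
      by (simp add: algebra_simps)
    \<comment> \<open>The terms of \<open>V\<close> all change by \<open>t * \<kappa>\<close> and no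
      term changes by more, so the conditions defining the cell persist.\<close>
    have rec: "x + t *\<^sub>R omega i \<in> C" if t: "t \<ge> 0" for t
    proof -
      have tV: "trop_term l v (x + t *\<^sub>R omega i) = trop_term l v x + t * \<kappa>" if "v \<in> V" for v
        using T[of v] 0[OF that] VA that by auto
      have tA: "trop_term l c (x + t *\<^sub>R omega i) \<le> trop_term l c x + t * \<kappa>" if "c \<in> A" for c
        using T[OF that] t by simp
      show ?thesis
        unfolding D(1) dual_cell_def V_def[symmetric]
      proof (intro CollectI conjI ballI)
        fix v w assume "v \<in> V" "w \<in> V"
        then show "trop_term l v (x + t *\<^sub>R omega i) = trop_term l w (x + t *\<^sub>R omega i)"
          using tV eqV[OF _ _ x] by metis
      next
        fix v c assume "v \<in> V" "c \<in> A"
        then show "trop_term l c (x + t *\<^sub>R omega i) \<le> trop_term l v (x + t *\<^sub>R omega i)"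
          using tV[of v] tA[of c] geV[OF _ _ x, of v c] by linarith
      qed
    qed
    obtain B where B: "\<And>y. y \<in> C \<Longrightarrow> norm y \<le> B"
      using compact_imp_bounded[OF cpt] by (auto simp: bounded_iff)
    have w: "norm (omega i) > 0" using i by (auto simp: omega_def vec_eq_iff forall_3)
    \<comment> \<open>Chosen so that the moved point has norm at least
      \<open>\<bar>B\<bar> + 1\<close>.\<close>
    define t where "t = (norm x + \<bar>B\<bar> + 1) / norm (omega i)"
    have "t \<ge> 0" using w by (simp add: t_def)
    have "norm (t *\<^sub>R omega i) = norm x + \<bar>B\<bar> + 1" using w \<open>t \<ge> 0\<close> by (simp add: t_def)
    moreover have "norm (t *\<^sub>R omega i) \<le> norm (x + t *\<^sub>R omega i) + norm x"
      by (metis add_diff_cancel_left' norm_triangle_ineq4)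
    ultimately show False using B[OF rec[OF \<open>t \<ge> 0\<close>]] by simp
  qed
  have A: "a \<in> A" "b \<in> A" using a b VA by auto
  have sums: "hexpo a 1 + (hexpo a 2 + (hexpo a 3 + hexpo a 4)) = 2"
    "hexpo b 1 + (hexpo b 2 + (hexpo b 3 + hexpo b 4)) = 2"
    using hexpo_sum[OF deg A(1) refl] hexpo_sum[OF deg A(2) refl] by auto
  have pos4: "hexpo a 1 + hexpo b 1 \<ge> 1" "hexpo a 2 + hexpo b 2 \<ge> 1"
    "hexpo a 3 + hexpo b 3 \<ge> 1" "hexpo a 4 + hexpo b 4 \<ge> 1"
    using pos by auto
  have key: thesis if "{i, j, k, m} = {1, 2, 3, 4}"
    "hexpo a i = 1 \<and> hexpo a j = 1 \<and> hexpo b k = 1 \<and> hexpo b m = 1" for i j k m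
    by (rule concl[OF that(1) A]) (use that(2) eqV[OF a b(1)] geV[OF a] in blast)+
  have perms: "{1, 2, 3, 4} = {1, 2, 3, 4 :: nat}" "{1, 3, 2, 4} = {1, 2, 3, 4 :: nat}"
    "{1, 4, 2, 3} = {1, 2, 3, 4 :: nat}" "{2, 3, 1, 4} = {1, 2, 3, 4 :: nat}"
    "{2, 4, 1, 3} = {1, 2, 3, 4 :: nat}" "{3, 4, 1, 2} = {1, 2, 3, 4 :: nat}" by auto
  \<comment> \<open>Four sums, each at least 1, total 4, so all equal 1. Hence \<open>b\<close> is
    complementary to \<open>a\<close>, and \<open>a\<close> has exactly two ones;
    \<open>perms\<close> lists the six possible pairs.\<close>
  have b1: "hexpo b 1 + hexpo a 1 = 1" "hexpo b 2 + hexpo a 2 = 1" "hexpo b 3 + hexpo a 3 = 1"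
    "hexpo b 4 + hexpo a 4 = 1"
    using sums pos4 by linarith+
  then have "hexpo a 1 = 0 \<or> hexpo a 1 = 1" "hexpo a 2 = 0 \<or> hexpo a 2 = 1"
    "hexpo a 3 = 0 \<or> hexpo a 3 = 1" "hexpo a 4 = 0 \<or> hexpo a 4 = 1"
    by linarith+
  then have "hexpo a 1 = 1 \<and> hexpo a 2 = 1 \<and> hexpo b 3 = 1 \<and> hexpo b 4 = 1 \<or>
    hexpo a 1 = 1 \<and> hexpo a 3 = 1 \<and> hexpo b 2 = 1 \<and> hexpo b 4 = 1 \<or>
    hexpo a 1 = 1 \<and> hexpo a 4 = 1 \<and> hexpo b 2 = 1 \<and> hexpo b 3 = 1 \<or>
    hexpo a 2 = 1 \<and> hexpo a 3 = 1 \<and> hexpo b 1 = 1 \<and> hexpo b 4 = 1 \<or>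
    hexpo a 2 = 1 \<and> hexpo a 4 = 1 \<and> hexpo b 1 = 1 \<and> hexpo b 3 = 1 \<or>
    hexpo a 3 = 1 \<and> hexpo a 4 = 1 \<and> hexpo b 1 = 1 \<and> hexpo b 2 = 1"
    using sums(1) b1 by (elim disjE; simp)
  then show thesis by (elim disjE) (erule key[OF perms(1)] key[OF perms(2)] key[OF perms(3)]
    key[OF perms(4)] key[OF perms(5)] key[OF perms(6)])+
qed

section \<open>Distinctness of the two lines\<close>

text \<open>
  \<open>c1, \<dots>, c4\<close> are the terms that stop the four half-lines at their start. As \<open>card S \<le> 4\<close>,
  they take only two values, hence \<open>a\<close> or \<open>b\<close> is the midpoint of two vertices of the Newton polytope.
\<close>

lemma no_common_degenerate:
  assumes fin: "finite A" and deg: "has_degree A 2" and perm: "{i, j, k, m} = {1, 2, 3, 4}"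
    and S: "S \<subseteq> A" "card S \<le> 4" "\<And>c. c \<in> S \<Longrightarrow> expo c extreme_point_of T"
    and a: "a \<in> S" "hexpo a i = 1" "hexpo a j = 1" and b: "b \<in> S" "hexpo b k = 1" "hexpo b m = 1"
    and c: "c1 \<in> S" "hexpo c1 i = 0" "hexpo c1 k = 0" "c2 \<in> S" "hexpo c2 j = 0" "hexpo c2 m = 0"
      "c3 \<in> S" "hexpo c3 i = 0" "hexpo c3 m = 0" "c4 \<in> S" "hexpo c4 j = 0" "hexpo c4 k = 0"
  shows False
proof -
  have sum: "hexpo v i + (hexpo v j + (hexpo v k + hexpo v m)) = 2" if "v \<in> S" for v
    using hexpo_sum[OF deg _ perm] that S by blast
  \<comment> \<open>Each of \<open>c1\<close> to \<open>c4\<close> lacks a variable of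
    \<open>a\<close> and a variable of \<open>b\<close>. Equality in \<open>ne2\<close> would leave
    a term of degree 0 in all four variables.\<close>
  have ne: "a \<noteq> b" "c1 \<noteq> a" "c1 \<noteq> b" "c2 \<noteq> a" "c2 \<noteq> b" "c3 \<noteq> a" "c3 \<noteq> b" "c4 \<noteq> a" "c4 \<noteq> b"
    using a b c sum[OF a(1)] by auto
  have ne2: "c1 \<noteq> c2" "c3 \<noteq> c4" using c sum[of c1] sum[of c3] by auto
  have "finite S" using S fin finite_subset by blast
  have mid: "\<not> (\<forall>n\<in>{1, 2, 3, 4}. 2 * hexpo u n = hexpo v n + hexpo w n)"
    if "u \<in> S" "v \<in> S" "w \<in> S" "v \<noteq> w" for u v w
  proof
    assume h: "\<forall>n\<in>{1, 2, 3, 4}. 2 * hexpo u n = hexpo v n + hexpo w n"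
    have "2 * u $ 1 = v $ 1 + w $ 1" "2 * u $ 2 = v $ 2 + w $ 2" "2 * u $ 3 = v $ 3 + w $ 3"
      using h by (auto simp: hexpo_def)
    then have "2 *\<^sub>R expo u = expo v + expo w"
      by (simp add: vec_eq_iff forall_3 expo_def flip: of_nat_add)
    moreover have "expo v \<noteq> expo w" using that(4) injD[OF inj_expo] by blast
    ultimately show False using extreme_point_not_midpoint[of "expo v" T "expo w" "expo u"] S(3) that by blast
  qed
  \<comment> \<open>\<open>a\<close>, \<open>b\<close>, \<open>c1\<close>, \<open>c2\<close> are
    distinct, so they exhaust \<open>S\<close>.\<close>
  have two: "c = c1 \<or> c = c2" if "c \<in> S" "c \<noteq> a" "c \<noteq> b" for c
  proof (rule ccontr)
    assume "\<not> ?thesis"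
    then have "card {a, b, c1, c2, c} = 5" using ne ne2 that by auto
    moreover have "card {a, b, c1, c2, c} \<le> card S"
      using \<open>finite S\<close> a b c that by (intro card_mono) auto
    ultimately show False using S(2) by simp
  qed
  \<comment> \<open>In the first case \<open>c1\<close> and \<open>c2\<close> are the squares of the
    variables \<open>j\<close> and \<open>i\<close>, with midpoint \<open>a\<close>; in the second
    they are the squares of \<open>m\<close> and \<open>k\<close>, with midpoint
    \<open>b\<close>.\<close>
  consider "c3 = c1" "c4 = c2" | "c3 = c2" "c4 = c1"
    using two[OF c(7)] two[OF c(10)] ne ne2 by blast
  then show False
  proof cases
    case 1
    then have "\<forall>n\<in>{i, j, k, m}. 2 * hexpo a n = hexpo c1 n + hexpo c2 n"
      using c a sum[of a] sum[of c1] sum[of c2] by auto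
    then show False using mid[of a c1 c2] a c ne2 perm by simp
  next
    case 2
    then have "\<forall>n\<in>{i, j, k, m}. 2 * hexpo b n = hexpo c1 n + hexpo c2 n"
      using c b sum[of b] sum[of c1] sum[of c2] by auto
    then show False using mid[of b c1 c2] b c ne2 perm by simp
  qed
qed

theorem theorem7p2:
  fixes A :: "(nat ^ 3) set" and l :: "nat ^ 3 \<Rightarrow> real"
    and C :: "(real ^ 3) set" and p :: "real ^ 3"
  assumes "finite A"
    and "smooth_of_degree A l 2"
    and "compact_2cell A l C"
    and "p \<in> C"
  shows "\<exists>L1 L2. L1 \<noteq> L2 \<and>
           tropical_line L1 \<and> L1 \<subseteq> trop_surface A l \<and> p \<in> L1 \<and>
           tropical_line L2 \<and> L2 \<subseteq> trop_surface A l \<and> p \<in> L2"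
proof -
  have deg: "has_degree A 2" and elem: "elementary_subdivision (Subdiv A l)"
    using assms(2) by (auto simp: smooth_of_degree_def)
  obtain i j k m a b where perm: "{i, j, k, m} = {1, 2, 3, 4}" and a: "a \<in> A" and b: "b \<in> A"
    and h: "hexpo a i = 1" "hexpo a j = 1" "hexpo b k = 1" "hexpo b m = 1"
    and tie: "trop_term l a p = trop_term l b p"
    and M: "\<And>c. c \<in> A \<Longrightarrow> trop_term l c p \<le> trop_term l a p"
    using compact_2cell_edge[OF assms(1) deg assms(3)] assms(4) by metis
  have perm': "{i, j, m, k} = {1, 2, 3, 4}" "{j, i, m, k} = {1, 2, 3, 4}" "{j, i, k, m} = {1, 2, 3, 4}"
    using perm by (simp_all add: insert_commute)
  define S where "S = {c \<in> A. \<forall>d\<in>A. trop_term l d p \<le> trop_term l c p}"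
  have inS: "c \<in> S" if "c \<in> A" "trop_term l c p = trop_term l a p" for c
    using that M by (simp add: S_def)
  obtain T where T: "card S \<le> 4" "\<And>c. c \<in> S \<Longrightarrow> expo c extreme_point_of T"
    using smooth_leading_terms[OF assms(1) _ elem, of p] a unfolding S_def by blast
  obtain L1 where L1: "tropical_line L1" "L1 \<subseteq> trop_surface A l" "p \<in> L1"
    "L1 \<subseteq> (+) p ` (cone2 i k \<union> cone2 j m)"
    "(\<exists>r>0. p + r *\<^sub>R (omega i + omega k) \<in> L1) \<or> (\<exists>r>0. p + r *\<^sub>R (omega j + omega m) \<in> L1) \<or>
     (\<exists>c\<in>A. trop_term l c p = trop_term l a p \<and> hexpo c i = 0 \<and> hexpo c k = 0) \<and>
     (\<exists>c\<in>A. trop_term l c p = trop_term l a p \<and> hexpo c j = 0 \<and> hexpo c m = 0)"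
    using ruling_line[OF assms(1) deg perm a refl h(1,2) b tie[symmetric] h(3,4) M] by blast
  \<comment> \<open>Exchanging \<open>k\<close> and \<open>m\<close> gives the other ruling.\<close>
  obtain L2 where L2: "tropical_line L2" "L2 \<subseteq> trop_surface A l" "p \<in> L2"
    "L2 \<subseteq> (+) p ` (cone2 i m \<union> cone2 j k)"
    "(\<exists>r>0. p + r *\<^sub>R (omega i + omega m) \<in> L2) \<or> (\<exists>r>0. p + r *\<^sub>R (omega j + omega k) \<in> L2) \<or>
     (\<exists>c\<in>A. trop_term l c p = trop_term l a p \<and> hexpo c i = 0 \<and> hexpo c m = 0) \<and>
     (\<exists>c\<in>A. trop_term l c p = trop_term l a p \<and> hexpo c j = 0 \<and> hexpo c k = 0)"
    using ruling_line[OF assms(1) deg perm'(1) a refl h(1,2) b tie[symmetric] h(4,3) M] by blast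
  have "L1 \<noteq> L2"
  proof
    assume eq: "L1 = L2"
    \<comment> \<open>A common line would lie in the cones of both rulings. The diagonals of each
      ruling avoid the cones of the other, so only the alternative with additional maximal terms
      remains in \<open>L1(5)\<close> and \<open>L2(5)\<close>.\<close>
    have cone: "v \<in> cone2 i k \<union> cone2 j m" "v \<in> cone2 i m \<union> cone2 j k" if "p + v \<in> L1" for v
      using that L1(4) L2(4) eq by auto
    have "p + r *\<^sub>R (omega i + omega k) \<notin> L1" "p + r *\<^sub>R (omega j + omega m) \<notin> L1"
      "p + r *\<^sub>R (omega i + omega m) \<notin> L1" "p + r *\<^sub>R (omega j + omega k) \<notin> L1" if r: "r > 0" for r
      using cone diagonal_notin_cone2[OF perm r] diagonal_notin_cone2[OF perm'(1) r]
        diagonal_notin_cone2[OF perm'(2) r] diagonal_notin_cone2[OF perm'(3) r] by blast+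
    then obtain c1 c2 c3 c4 where "c1 \<in> A" "trop_term l c1 p = trop_term l a p" "hexpo c1 i = 0" "hexpo c1 k = 0"
      "c2 \<in> A" "trop_term l c2 p = trop_term l a p" "hexpo c2 j = 0" "hexpo c2 m = 0"
      "c3 \<in> A" "trop_term l c3 p = trop_term l a p" "hexpo c3 i = 0" "hexpo c3 m = 0"
      "c4 \<in> A" "trop_term l c4 p = trop_term l a p" "hexpo c4 j = 0" "hexpo c4 k = 0"
      using L1(5) L2(5) eq by metis
    then show False
      using no_common_degenerate[OF assms(1) deg perm _ T inS[OF a refl] h(1,2) inS[OF b tie[symmetric]] h(3,4),
          of c1 c2 c3 c4] inS
      by (auto simp: S_def)
  qed
  then show ?thesis using L1 L2 by blast
qed

end
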